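(* Let $X$ be a groupspace and let $i\in\mathbb{N}$. Then $\sim_i$ is a groupspace congruence of $X$ and $X/\sim_i$ (with the push-forward cubic structure) is an $i$-step groupspace.
   Context: Notation: $[n]=\{1,\dots,n\}$; $\{0,1\}^0$ is a one point set; $1^n$ is the all-one vector; $\{0,1\}^n_*=\{0,1\}^n\setminus\{1^n\}$. $\mathcal{G}$-morphisms: a map $\phi:\{0,1\}^n\to\{0,1\}^m$ is a morphism in $\mathcal{G}$ if for every $i\in[m]$ the function $v\mapsto\phi(v)_i$ is either constant (then put $\gamma_\phi(i)=0$) or equal to $v\mapsto v_j$ or $v\mapsto 1-v_j$ for some $j\in[n]$ (then put $\gamma_\phi(i)=j$), and for all $1\le i<j\le m$ either $\gamma_\phi(j)=0$ or $\gamma_\phi(i)\le\gamma_\phi(j)$. For $i\in[n]$, $j\in\{0,1\}$ the face embedding $e^n_{i,j}:\{0,1\}^{n-1}\to\{0,1\}^n$ is $e^n_{i,j}(x_1,\dots,x_{n-1})=(x_1,\dots,x_{i-1},j,x_i,\dots,x_{n-1})$. A cube-structure is a set $X$ with subsets $C^n(X)\subseteq X^{\{0,1\}^n}$ for $n=0,1,2,\dots$. It is a groupspace if: (presheaf) $\psi\in C^m(X)$ and $\phi:\{0,1\}^n\to\{0,1\}^m$ a morphism in $\mathcal{G}$ imply $\psi\circ\phi\in C^n(X)$; (ergodicity) $C^1(X)=X^{\{0,1\}}$; (completion) for every $n\ge 0$, if $f:\{0,1\}^n_*\to X$ satisfies $f\circ e^n_{i,0}\in C^{n-1}(X)$ for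 all $i\in[n]$, then some $\phi\in C^n(X)$ restricts to $f$ on $\{0,1\}^n_*$. A groupspace is $k$-step if for $n=k+1$ the completion $\phi$ is always uniquely determined by $f$. For an equivalence relation $\sim$ on a groupspace $X$ with factor map $m:X\to X/\sim$, the push-forward cubic structure is $C^n(X/\sim)=\{m\circ c: c\in C^n(X)\}$; $\sim$ is a congruence of $X$ if $X/\sim$ with this structure is a groupspace. For $x,y\in X$ and $i\in\mathbb{N}$, $x\sim_i y$ means there are $c_1,c_2\in C^{i+1}(X)$ with $c_1(1^{i+1})=x$, $c_2(1^{i+1})=y$ and $c_1(v)=c_2(v)$ for every $v\in\{0,1\}^{i+1}_*$; this is an equivalence relation on $X$. *)

theory Defs
  imports Main "HOL-Library.FuncSet"
begin

text \<open>
  Vertices of \<open>{0,1}\<^sup>n\<close> are Boolean lists of length \<open>n\<close>, with \<open>False\<close> for 0 and \<open>True\<close> for 1.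
  Coordinates are numbered from 1, so that 0 is free to mark constant coordinates of a morphism.
  Maps with domain \<open>{0,1}\<^sup>n\<close> are represented by extensional functions.
\<close>

definition vertices :: "nat \<Rightarrow> bool list set" where
  "vertices n = {v. length v = n}"

definition ones :: "nat \<Rightarrow> bool list" where
  "ones n = replicate n True"

definition punctured :: "nat \<Rightarrow> bool list set" where
  "punctured n = vertices n - {ones n}"

definition coord :: "bool list \<Rightarrow> nat \<Rightarrow> bool" where
  "coord v i = v ! (i - 1)"

text \<open>
  The index \<open>\<gamma> i\<close> is determined by \<open>\<phi>\<close> for every \<open>i \<in> {1..m}\<close>, because the functions
  \<open>v \<mapsto> v\<^sub>j\<close> and \<open>v \<mapsto> 1 - v\<^sub>j\<close> are non-constant and different for different \<open>j\<close>.
\<close>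

definition morphism :: "nat \<Rightarrow> nat \<Rightarrow> (bool list \<Rightarrow> bool list) \<Rightarrow> bool" where
  "morphism n m \<phi> \<longleftrightarrow>
     \<phi> \<in> vertices n \<rightarrow> vertices m \<and>
     (\<exists>\<gamma> :: nat \<Rightarrow> nat.
        (\<forall>i\<in>{1..m}.
           (\<gamma> i = 0 \<and> (\<exists>b. \<forall>v\<in>vertices n. coord (\<phi> v) i = b)) \<or>
           (\<gamma> i \<in> {1..n} \<and>
              ((\<forall>v\<in>vertices n. coord (\<phi> v) i = coord v (\<gamma> i)) \<or>
               (\<forall>v\<in>vertices n. coord (\<phi> v) i = (\<not> coord v (\<gamma> i)))))) \<and>
        (\<forall>i j. 1 \<le> i \<and> i < j \<and> j \<le> m \<longrightarrow> \<gamma> j = 0 \<or> \<gamma> i \<le> \<gamma> j))"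

definition face :: "nat \<Rightarrow> bool \<Rightarrow> bool list \<Rightarrow> bool list" where
  "face i b v = take (i - 1) v @ b # drop (i - 1) v"

definition corner :: "'a set \<Rightarrow> (nat \<Rightarrow> (bool list \<Rightarrow> 'a) set) \<Rightarrow> nat \<Rightarrow> (bool list \<Rightarrow> 'a) \<Rightarrow> bool" where
  "corner X C n f \<longleftrightarrow>
     f \<in> punctured n \<rightarrow>\<^sub>E X \<and>
     (\<forall>i\<in>{1..n}. compose (vertices (n - 1)) f (face i False) \<in> C (n - 1))"

locale cube_structure =
  fixes X :: "'a set" and C :: "nat \<Rightarrow> (bool list \<Rightarrow> 'a) set"
  assumes cubes: "C n \<subseteq> vertices n \<rightarrow>\<^sub>E X"

locale groupspace = cube_structure X C
  for X :: "'a set" and C :: "nat \<Rightarrow> (bool list \<Rightarrow> 'a) set" +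
  assumes presheaf: "\<psi> \<in> C m \<Longrightarrow> morphism n m \<phi> \<Longrightarrow> compose (vertices n) \<psi> \<phi> \<in> C n"
    and ergodicity: "C 1 = vertices 1 \<rightarrow>\<^sub>E X"
    and completion: "corner X C n f \<Longrightarrow> \<exists>\<phi>\<in>C n. restrict \<phi> (punctured n) = f"

locale step_groupspace = groupspace X C
  for k :: nat and X :: "'a set" and C :: "nat \<Rightarrow> (bool list \<Rightarrow> 'a) set" +
  assumes unique_completion:
    "corner X C (k + 1) f \<Longrightarrow> \<exists>!\<phi>. \<phi> \<in> C (k + 1) \<and> restrict \<phi> (punctured (k + 1)) = f"

definition push_forward ::
  "('a \<times> 'a) set \<Rightarrow> (nat \<Rightarrow> (bool list \<Rightarrow> 'a) set) \<Rightarrow> nat \<Rightarrow> (bool list \<Rightarrow> 'a set) set" where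
  "push_forward R C n = {compose (vertices n) (\<lambda>x. R `` {x}) c | c. c \<in> C n}"

definition congruence ::
  "'a set \<Rightarrow> (nat \<Rightarrow> (bool list \<Rightarrow> 'a) set) \<Rightarrow> ('a \<times> 'a) set \<Rightarrow> bool" where
  "congruence X C R \<longleftrightarrow> equiv X R \<and> groupspace (X // R) (push_forward R C)"

definition sim :: "'a set \<Rightarrow> (nat \<Rightarrow> (bool list \<Rightarrow> 'a) set) \<Rightarrow> nat \<Rightarrow> ('a \<times> 'a) set" where
  "sim X C i = {(x, y). x \<in> X \<and> y \<in> X \<and>
     (\<exists>c\<^sub>1\<in>C (i + 1). \<exists>c\<^sub>2\<in>C (i + 1).
        c\<^sub>1 (ones (i + 1)) = x \<and> c\<^sub>2 (ones (i + 1)) = y \<and>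
        (\<forall>v\<in>punctured (i + 1). c\<^sub>1 v = c\<^sub>2 v))}"

end

theory Submission
  imports Defs
begin

text \<open>
  Filling in vertices one at a time, in order of weight, extends partial cubes defined on a
  down-closed set of vertices. In dimension \<open>2 * n\<close> this glues a subdivided cube from its small
  cubes. Gluing shows that \<open>x \<sim>\<^sub>k y\<close> may be tested on any cube of dimension \<open>k + 1\<close> with top
  value \<open>x\<close>, so \<open>\<sim>\<^sub>k\<close> is an equivalence relation, the cubes of dimension at most \<open>k + 1\<close> are closed
  under changing values within \<open>\<sim>\<^sub>k\<close>-classes, and from dimension \<open>k + 1\<close> on the class at
  the top vertex is determined by the other classes. Hence a corner of the quotient can be
  lifted vertex by vertex: in small dimensions any representative will do, and in large ones any
  completion automatically lies in the required class.
\<close>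

section \<open>Vertices and the all-one vertex\<close>

lemma mem_vertices_iff [simp]: "v \<in> vertices n \<longleftrightarrow> length v = n"
  by (simp add: vertices_def)

lemma length_ones [simp]: "length (ones n) = n"
  by (simp add: ones_def)

lemma ones_simps [simp]: "ones 0 = []" "ones (Suc n) = True # ones n"
  by (simp_all add: ones_def)

lemma mem_punctured_iff [simp]: "v \<in> punctured n \<longleftrightarrow> length v = n \<and> v \<noteq> ones n"
  by (simp add: punctured_def)

lemma finite_vertices: "finite (vertices n)"
  using finite_lists_length_eq[of "UNIV :: bool set" n] by (simp add: vertices_def)

section \<open>Morphisms\<close>

lemma coord_Cons_simps [simp]:
  "coord (b # v) (Suc 0) = b"
  "1 \<le> i \<Longrightarrow> coord (b # v) (Suc i) = coord v i"
  by (auto simp: coord_def nth_Cons split: nat.splits)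

lemma coord_1: "length v = Suc n \<Longrightarrow> coord v (Suc 0) = hd v"
  by (cases v) auto

lemma morphism_mem: "morphism n m \<phi> \<Longrightarrow> length v = n \<Longrightarrow> length (\<phi> v) = m"
  by (auto simp: morphism_def Pi_iff)

text \<open>The clause of \<open>morphism\<close> for one coordinate function \<open>f\<close>,
  separated out so that morphisms can be assembled coordinate by coordinate.\<close>

definition reads :: "nat \<Rightarrow> nat \<Rightarrow> (bool list \<Rightarrow> bool) \<Rightarrow> bool" where
  "reads n k f \<longleftrightarrow>
     (k = 0 \<and> (\<exists>b. \<forall>v\<in>vertices n. f v = b)) \<or>
     (k \<in> {1..n} \<and>
        ((\<forall>v\<in>vertices n. f v = coord v k) \<or> (\<forall>v\<in>vertices n. f v = (\<not> coord v k))))"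

lemma reads_cong: "(\<And>v. length v = n \<Longrightarrow> f v = g v) \<Longrightarrow> reads n k f \<longleftrightarrow> reads n k g"
  by (simp add: reads_def)

lemma reads_tl: "reads n k f \<Longrightarrow> reads (Suc n) (if k = 0 then 0 else Suc k) (\<lambda>v. f (tl v))"
proof -
  assume f: "reads n k f"
  have tl: "tl v \<in> vertices n" "coord (tl v) j = coord v (Suc j)"
    if "v \<in> vertices (Suc n)" "1 \<le> j" for v j
    using that by (auto simp: length_Suc_conv)
  show ?thesis
  proof (cases "k = 0")
    case True
    with f obtain b where "\<forall>v\<in>vertices n. f v = b" by (auto simp: reads_def)
    then have "\<forall>v\<in>vertices (Suc n). f (tl v) = b" by simp
    then show ?thesis using True by (auto simp: reads_def)
  next
    case False
    with f have k: "k \<in> {1..n}"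
      "(\<forall>v\<in>vertices n. f v = coord v k) \<or> (\<forall>v\<in>vertices n. f v = (\<not> coord v k))"
      unfolding reads_def by blast+
    then have "(\<forall>v\<in>vertices (Suc n). f (tl v) = coord v (Suc k)) \<or>
        (\<forall>v\<in>vertices (Suc n). f (tl v) = (\<not> coord v (Suc k)))"
      using tl[where j = k] by (metis atLeastAtMost_iff)
    then show ?thesis using k(1) unfolding reads_def by simp
  qed
qed

lemma morphism_iff_reads:
  "morphism n m \<phi> \<longleftrightarrow>
     \<phi> \<in> vertices n \<rightarrow> vertices m \<and>
     (\<exists>\<gamma>. (\<forall>i\<in>{1..m}. reads n (\<gamma> i) (\<lambda>v. coord (\<phi> v) i)) \<and>
          (\<forall>i j. 1 \<le> i \<and> i < j \<and> j \<le> m \<longrightarrow> \<gamma> j = 0 \<or> \<gamma> i \<le> \<gamma> j))"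
  unfolding morphism_def reads_def by (rule refl)

lemma morphism_cong:
  assumes "morphism n m \<phi>" "\<And>v. length v = n \<Longrightarrow> \<phi> v = \<psi> v"
  shows "morphism n m \<psi>"
proof -
  have "reads n k (\<lambda>v. coord (\<phi> v) i) \<longleftrightarrow> reads n k (\<lambda>v. coord (\<psi> v) i)" for k i
    using assms(2) by (intro reads_cong) simp
  moreover have "\<phi> \<in> vertices n \<rightarrow> vertices m \<longleftrightarrow> \<psi> \<in> vertices n \<rightarrow> vertices m"
    using assms(2) by (simp add: Pi_iff)
  ultimately show ?thesis
    using assms(1) unfolding morphism_iff_reads by simp
qed

lemma morphism_Nil: "morphism n 0 (\<lambda>_. [])"
  by (auto simp: morphism_def)

text \<open>The new coordinate comes first, so its index must not exceed any nonzero index after it;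
  \<open>g \<le> 1\<close> guarantees this whatever the indices of \<open>\<phi>\<close>
  are.\<close>

lemma morphism_Cons:
  assumes \<phi>: "morphism n m \<phi>" and f: "reads n g f" and g: "g \<le> 1"
  shows "morphism n (Suc m) (\<lambda>v. f v # \<phi> v)"
proof -
  obtain \<gamma> where
    \<gamma>: "\<forall>i\<in>{1..m}. reads n (\<gamma> i) (\<lambda>v. coord (\<phi> v) i)"
    and mono: "\<forall>i j. 1 \<le> i \<and> i < j \<and> j \<le> m \<longrightarrow> \<gamma> j = 0 \<or> \<gamma> i \<le> \<gamma> j"
    using \<phi> unfolding morphism_iff_reads by blast
  define \<gamma>' where "\<gamma>' i = (if i \<le> 1 then g else \<gamma> (i - 1))" for i
  show ?thesis
    unfolding morphism_iff_reads
  proof (intro conjI exI[of _ \<gamma>'] ballI allI impI)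
    show "(\<lambda>v. f v # \<phi> v) \<in> vertices n \<rightarrow> vertices (Suc m)"
      using morphism_mem[OF \<phi>] by simp
  next
    fix i assume i: "i \<in> {1..Suc m}"
    show "reads n (\<gamma>' i) (\<lambda>v. coord (f v # \<phi> v) i)"
    proof (cases "i = 1")
      case True
      then show ?thesis using f by (simp add: \<gamma>'_def)
    next
      case False
      then obtain k where "i = Suc k" "k \<in> {1..m}" using i by (cases i) auto
      then show ?thesis using bspec[OF \<gamma>, of k] by (simp add: \<gamma>'_def)
    qed
  next
    fix i j assume ij: "1 \<le> i \<and> i < j \<and> j \<le> Suc m"
    show "\<gamma>' j = 0 \<or> \<gamma>' i \<le> \<gamma>' j"
    proof (cases "i = 1")
      case True
      then show ?thesis using ij g by (auto simp: \<gamma>'_def)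
    next
      case False
      then have "1 \<le> i - 1 \<and> i - 1 < j - 1 \<and> j - 1 \<le> m" using ij by auto
      then show ?thesis using mono ij False by (auto simp: \<gamma>'_def)
    qed
  qed
qed

lemma morphism_Cons_const: "morphism n m \<phi> \<Longrightarrow> morphism n (Suc m) (\<lambda>v. b # \<phi> v)"
  by (rule morphism_Cons[where g = 0]) (auto simp: reads_def)

text \<open>A Boolean function of one variable is constant, the identity or negation. The map
  \<open>\<phi>\<close> may read the head too, since indices need only increase weakly.\<close>

lemma morphism_Cons_hd:
  assumes "morphism (Suc n) m \<phi>"
  shows "morphism (Suc n) (Suc m) (\<lambda>v. h (hd v) # \<phi> v)"
proof -
  consider (const) b where "h = (\<lambda>_. b)" | (id) "h = (\<lambda>x. x)" | (neg) "h = Not"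
    by (cases "h True"; cases "h False"; force simp: fun_eq_iff all_bool_eq)
  then show ?thesis
  proof cases
    case const
    then show ?thesis using morphism_Cons_const[OF assms] by simp
  next
    case id
    then show ?thesis by (intro morphism_Cons[where g = 1] assms) (auto simp: reads_def coord_1)
  next
    case neg
    then show ?thesis by (intro morphism_Cons[where g = 1] assms) (auto simp: reads_def coord_1)
  qed
qed

lemma morphism_tl:
  assumes "morphism n m \<phi>"
  shows "morphism (Suc n) m (\<lambda>v. \<phi> (tl v))"
proof -
  obtain \<gamma> where
    \<gamma>: "\<forall>i\<in>{1..m}. reads n (\<gamma> i) (\<lambda>v. coord (\<phi> v) i)"
    and mono: "\<forall>i j. 1 \<le> i \<and> i < j \<and> j \<le> m \<longrightarrow> \<gamma> j = 0 \<or> \<gamma> i \<le> \<gamma> j"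
    using assms unfolding morphism_iff_reads by blast
  define \<gamma>' where "\<gamma>' i = (if \<gamma> i = 0 then 0 else Suc (\<gamma> i))" for i
  show ?thesis
    unfolding morphism_iff_reads
  proof (intro conjI exI[of _ \<gamma>'] ballI)
    show "(\<lambda>v. \<phi> (tl v)) \<in> vertices (Suc n) \<rightarrow> vertices m"
      using morphism_mem[OF assms] by simp
    show "\<forall>i j. 1 \<le> i \<and> i < j \<and> j \<le> m \<longrightarrow> \<gamma>' j = 0 \<or> \<gamma>' i \<le> \<gamma>' j"
      using mono unfolding \<gamma>'_def by (metis Suc_le_mono le0)
    show "reads (Suc n) (\<gamma>' i) (\<lambda>v. coord (\<phi> (tl v)) i)" if "i \<in> {1..m}" for i
      unfolding \<gamma>'_def using reads_tl[OF bspec[OF \<gamma> that]] .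
  qed
qed

lemma morphism_Cons_hd_tl:
  "morphism n m \<phi> \<Longrightarrow> morphism (Suc n) (Suc m) (\<lambda>v. h (hd v) # \<phi> (tl v))"
  by (intro morphism_Cons_hd morphism_tl)

lemma morphism_id: "morphism n n (\<lambda>v. v)"
proof (induction n)
  case 0
  show ?case by (rule morphism_cong[OF morphism_Nil]) simp
next
  case (Suc n)
  show ?case
    by (rule morphism_cong[OF morphism_Cons_hd_tl[OF Suc, where h = "\<lambda>x. x"]])
      (auto simp: length_Suc_conv)
qed

lemma morphism_drop: "morphism (k + n) n (drop k)"
proof (induction k)
  case 0
  show ?case by (auto intro: morphism_cong[OF morphism_id])
next
  case (Suc k)
  then show ?case using morphism_tl[OF Suc] by (simp add: drop_Suc)
qed

lemma morphism_append: "morphism n (length u + n) (append u)"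
proof (induction u)
  case Nil
  show ?case by (auto intro: morphism_cong[OF morphism_id])
next
  case (Cons b u)
  then show ?case using morphism_Cons_const[OF Cons] by simp
qed

text \<open>\<open>map2 (=) w\<close> flips exactly the coordinates where \<open>w\<close> is 0, so
  it is an involution carrying \<open>w\<close> to the top vertex.\<close>

lemma morphism_reflection: "morphism (length w) (length w) (map2 (=) w)"
proof (induction w)
  case Nil
  show ?case by (auto intro: morphism_cong[OF morphism_Nil])
next
  case (Cons b w)
  then show ?case
    by (auto intro!: morphism_cong[OF morphism_Cons_hd_tl[OF Cons, where h = "(=) b"]]
        simp: length_Suc_conv)
qed

lemma reflection_involution:
  "length w = n \<Longrightarrow> length v = n \<Longrightarrow> map2 (=) w (map2 (=) w v) = v"
  by (induction w v arbitrary: n rule: list_induct2') auto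

lemma reflection_eq_ones_iff:
  "length w = n \<Longrightarrow> length v = n \<Longrightarrow> map2 (=) w v = ones n \<longleftrightarrow> v = w"
  by (induction w v arbitrary: n rule: list_induct2') auto

section \<open>Lower subcubes\<close>

definition weight :: "bool list \<Rightarrow> nat" where
  "weight w = count_list w True"

lemma weight_simps [simp]: "weight [] = 0" "weight (b # w) = (if b then Suc (weight w) else weight w)"
  by (simp_all add: weight_def)

lemma weight_append [simp]: "weight (u @ v) = weight u + weight v"
  by (simp add: weight_def)

lemma weight_le: "weight v \<le> length v"
  by (simp add: weight_def count_le_length)

lemma weight_ones [simp]: "weight (ones n) = n"
  by (induction n) auto

lemma weight_eq_length_iff: "weight v = length v \<longleftrightarrow> v = ones (length v)"
proof (induction v)
  case (Cons b v)
  then show ?case using weight_le[of v] by (cases b) auto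
qed simp

lemma weight_less: "length v = n \<Longrightarrow> v \<noteq> ones n \<Longrightarrow> weight v < n"
  using weight_le[of v] weight_eq_length_iff[of v] by fastforce

text \<open>\<open>lower w\<close> parametrizes the subcube of all vertices lying below \<open>w\<close>.\<close>

fun lower :: "bool list \<Rightarrow> bool list \<Rightarrow> bool list" where
  "lower [] v = []"
| "lower (b # w) v = (if b then hd v # lower w (tl v) else False # lower w v)"

lemma length_lower [simp]: "length (lower w v) = length w"
  by (induction w arbitrary: v) auto

lemma lower_ones [simp]: "lower w (ones (weight w)) = w"
  by (induction w) auto

lemma lower_of_ones: "length v = n \<Longrightarrow> lower (ones n) v = v"
  by (induction n arbitrary: v) (auto simp: length_Suc_conv)

lemma weight_lower: "length v = weight w \<Longrightarrow> weight (lower w v) = weight v"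
  by (induction w arbitrary: v) (auto simp: length_Suc_conv)

text \<open>Being below is transitive; this identifies the faces of the corner under
  \<open>w\<close> with subcubes already filled in.\<close>

lemma lower_lower:
  "length u = weight w \<Longrightarrow> length v = weight u \<Longrightarrow> lower w (lower u v) = lower (lower w u) v"
  by (induction w arbitrary: u v) (auto simp: length_Suc_conv split: if_splits)

lemma lower_neq: "length v = weight w \<Longrightarrow> v \<noteq> ones (weight w) \<Longrightarrow> lower w v \<noteq> w"
  using weight_lower[of v w] weight_less[of v "weight w"] by fastforce

lemma morphism_lower: "morphism (weight w) (length w) (lower w)"
proof (induction w)
  case Nil
  show ?case by (auto intro: morphism_cong[OF morphism_Nil])
next
  case (Cons b w)
  show ?case
    using morphism_Cons_hd_tl[OF Cons, where h = "\<lambda>x. x"] morphism_Cons_const[OF Cons, of False]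
    by (cases b) auto
qed

text \<open>The face where coordinate \<open>i\<close> is 0 lies below the vertex whose only zero is
  at \<open>i\<close>, so corners can be phrased through \<open>lower\<close>.\<close>

lemma face_eq_lower:
  assumes "1 \<le> i" "i \<le> n" "length v = n - 1"
  shows "face i False v = lower (face i False (ones (n - 1))) v"
proof -
  have "\<And>v j. j \<le> length v \<Longrightarrow>
    take j v @ False # drop j v = lower (take j (ones (length v)) @ False # drop j (ones (length v))) v"
  proof -
    fix v j
    show "j \<le> length v \<Longrightarrow>
    take j v @ False # drop j v = lower (take j (ones (length v)) @ False # drop j (ones (length v))) v"
    by (induction v arbitrary: j) (auto simp: lower_of_ones take_Cons drop_Cons split: nat.splits)
  qed
  from this[of "i - 1" v] show ?thesis
    using assms by (simp add: face_def)
qed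

lemma length_face: "1 \<le> i \<Longrightarrow> i \<le> n \<Longrightarrow> length v = n - 1 \<Longrightarrow> length (face i b v) = n"
  by (auto simp: face_def)

lemma weight_face_ones: "1 \<le> i \<Longrightarrow> i \<le> n \<Longrightarrow> weight (face i False (ones (n - 1))) = n - 1"
  using weight_ones[unfolded ones_def] by (auto simp: face_def ones_def)

lemma face_neq_ones:
  assumes "1 \<le> i" "i \<le> n" "length v = n - 1"
  shows "face i False v \<noteq> ones n"
proof
  assume "face i False v = ones n"
  then have "face i False v ! (i - 1) = ones n ! (i - 1)" by simp
  then show False using assms by (auto simp: face_def nth_append ones_def)
qed

lemma punctured_is_face:
  assumes "w \<in> punctured n"
  obtains i v where "1 \<le> i" "i \<le> n" "length v = n - 1" "w = face i False v"
proof -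
  have "False \<in> set w"
  proof (rule ccontr)
    assume "False \<notin> set w"
    then have "w = ones (length w)" by (induction w) auto
    then show False using assms by simp
  qed
  then obtain xs ys where w: "w = xs @ False # ys" by (auto simp: in_set_conv_decomp)
  show thesis
    using assms by (intro that[of "Suc (length xs)" "xs @ ys"]) (auto simp: w face_def)
qed

section \<open>Doubled coordinates\<close>

text \<open>
  A pair of adjacent coordinates \<open>(a, b)\<close> with \<open>(1,0)\<close>, \<open>(0,0)\<close>, \<open>(0,1)\<close> encodes the three points
  of a subdivided edge, in this order; \<open>(1,1)\<close> is the vertex to be filled in by completion.
\<close>

fun pairwise :: "(bool \<Rightarrow> bool \<Rightarrow> bool) \<Rightarrow> bool list \<Rightarrow> bool list" where
  "pairwise h (a # b # w) = h a b # pairwise h w"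
| "pairwise h _ = []"

fun separated :: "bool list \<Rightarrow> bool" where
  "separated (a # b # w) \<longleftrightarrow> \<not> (a \<and> b) \<and> separated w"
| "separated _ \<longleftrightarrow> True"

text \<open>The pairs (1,0) and (0,1) are the two ends of a subdivided edge, so
  \<open>antidiag\<close> embeds the outer cube.\<close>

fun antidiag :: "bool list \<Rightarrow> bool list" where
  "antidiag [] = []"
| "antidiag (b # v) = (\<not> b) # b # antidiag v"

lemma length_antidiag [simp]: "length (antidiag v) = 2 * length v"
  by (induction v) auto

lemma pairwise_antidiag [simp]: "pairwise h (antidiag v) = map (\<lambda>b. h (\<not> b) b) v"
  by (induction v) auto

lemma antidiag_inject [simp]: "antidiag v = antidiag w \<longleftrightarrow> v = w"
proof
  assume "antidiag v = antidiag w"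
  then have "pairwise (\<lambda>a b. b) (antidiag v) = pairwise (\<lambda>a b. b) (antidiag w)" by simp
  then show "v = w" by simp
qed simp

lemma separated_antidiag [simp]: "separated (antidiag v)"
  by (induction v) auto

lemma separated_lower: "separated w \<Longrightarrow> separated (lower w v)"
  by (induction w arbitrary: v rule: separated.induct) auto

lemma weight_antidiag [simp]: "weight (antidiag v) = length v"
  by (induction v) auto

lemma pairwise_lower_antidiag_ones:
  "length v = n \<Longrightarrow> pairwise h (lower (antidiag (ones n)) v) = map (h False) v"
  by (induction n arbitrary: v) (auto simp: length_Suc_conv)

text \<open>Every pair of \<open>antidiag (ones n)\<close> is (0,1), and raising its zero gives the
  excluded pair (1,1). Hence only one small cube sees a change of value at this vertex.\<close>

lemma antidiag_ones_maximal:
  "separated w \<Longrightarrow> length w = 2 * n \<Longrightarrow> lower w v = antidiag (ones n) \<Longrightarrow> w = antidiag (ones n)"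
proof (induction n arbitrary: w v)
  case (Suc n)
  then obtain a b u where w: "w = a # b # u" "length u = 2 * n"
    by (auto simp: length_Suc_conv)
  with Suc.prems have "\<not> a" "b" and lower: "lower u (tl v) = antidiag (ones n)"
    by (cases a; cases b; simp)+
  moreover have "u = antidiag (ones n)"
    using Suc.IH[OF _ w(2) lower] Suc.prems(1) w(1) by simp
  ultimately show ?case using w(1) by simp
qed simp

lemma morphism_antidiag: "morphism n (2 * n) antidiag"
proof (induction n)
  case 0
  show ?case by (auto intro: morphism_cong[OF morphism_Nil])
next
  case (Suc n)
  have "morphism (Suc n) (2 * Suc n) (\<lambda>v. (\<not> hd v) # hd v # antidiag (tl v))"
    using morphism_Cons_hd[OF morphism_Cons_hd_tl[OF Suc, where h = "\<lambda>b. b"], where h = Not] by simp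
  then show ?case by (rule morphism_cong) (auto simp: length_Suc_conv)
qed

text \<open>Below a separated vertex at most one entry of each pair is free, so each value of
  \<open>h\<close> depends on at most one coordinate, and these occur in order.\<close>

lemma morphism_pairwise_lower:
  "separated w \<Longrightarrow> length w = 2 * n \<Longrightarrow> morphism (weight w) n (\<lambda>v. pairwise h (lower w v))"
proof (induction n arbitrary: w)
  case 0
  then show ?case by (auto intro: morphism_cong[OF morphism_Nil])
next
  case (Suc n)
  then obtain a b u where w: "w = a # b # u" "length u = 2 * n" "separated u" "\<not> (a \<and> b)"
    by (auto simp: length_Suc_conv)
  note IH = Suc.IH[OF w(3,2)]
  show ?case
    using w(4) morphism_Cons_const[OF IH, of "h False False"]
      morphism_Cons_hd_tl[OF IH, where h = "\<lambda>x. h x False"]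
      morphism_Cons_hd_tl[OF IH, where h = "\<lambda>x. h False x"]
    by (cases a; cases b) (simp_all add: w(1))
qed

section \<open>Cubes with prescribed constraints\<close>

lemma compose_compose_morphism:
  "morphism n m \<phi> \<Longrightarrow>
    compose (vertices n) (compose (vertices m) g c) \<phi> = compose (vertices n) g (compose (vertices n) c \<phi>)"
  using morphism_mem by (fastforce simp: compose_def fun_eq_iff)

context groupspace
begin

lemma cube_mem: "c \<in> C n \<Longrightarrow> length v = n \<Longrightarrow> c v \<in> X"
  using cubes by (fastforce simp: PiE_iff)

lemma cube_eqI:
  assumes "c \<in> C n" "d \<in> extensional (vertices n)" "\<And>v. length v = n \<Longrightarrow> c v = d v"
  shows "d \<in> C n"
proof -
  have "c = d"
    using assms cubes[of n] by (intro extensionalityI[of c "vertices n" d]) (auto simp: PiE_iff)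
  then show ?thesis using assms by simp
qed

lemma const_cube: "x \<in> X \<Longrightarrow> (\<lambda>v\<in>vertices n. x) \<in> C n"
proof -
  assume "x \<in> X"
  then have 1: "(\<lambda>v\<in>vertices 1. x) \<in> C 1" unfolding ergodicity by simp
  have "morphism n 1 (\<lambda>v. [False])"
    using morphism_Cons_const[OF morphism_Nil] by simp
  from presheaf[OF 1 this] show ?thesis by (simp add: compose_def cong: restrict_cong)
qed

text \<open>\<open>A w\<close> holds the values allowed at \<open>w\<close>. The recursion follows
  the weight: when \<open>w\<close> is reached, the values strictly below it form a corner, and
  \<open>extend\<close> completes it with an allowed top value.\<close>

lemma constrained_completion:
  assumes extend: "\<And>w f. w \<in> vertices n \<Longrightarrow> corner X C (weight w) f \<Longrightarrow>
      (\<forall>v\<in>punctured (weight w). f v \<in> A (lower w v)) \<Longrightarrow>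
      \<exists>c\<in>C (weight w). restrict c (punctured (weight w)) = f \<and> c (ones (weight w)) \<in> A w"
  shows "\<exists>F\<in>C n. \<forall>w\<in>vertices n. F w \<in> A w"
proof -
  \<comment> \<open>\<open>z\<close> is admissible at \<open>w\<close> if it is allowed and, placed
    on the values of \<open>F\<close> below \<open>w\<close>, yields a cube. Lists of other lengths
    are unconstrained, so that \<open>F\<close> can be chosen on all lists.\<close>
  define P where "P F w z \<longleftrightarrow> (length w = n \<longrightarrow>
      z \<in> A w \<and> compose (vertices (weight w)) (F(w := z)) (lower w) \<in> C (weight w))" for F w z
  have "\<exists>F. \<forall>w. P F w (F w)"
  proof (rule dependent_wf_choice)
    show "wf (measure weight)" by simp
  next
    fix F G :: "bool list \<Rightarrow> 'a" and w z
    assume "\<And>u. (u, w) \<in> measure weight \<Longrightarrow> F u = G u"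
    then have "(F(w := z)) (lower w v) = (G(w := z)) (lower w v)" if "length v = weight w" for v
      using that weight_less[of v "weight w"] weight_lower[of v w] by (cases "v = ones (weight w)") auto
    then show "P F w z = P G w z" by (simp add: P_def compose_def cong: restrict_cong)
  next
    fix w and F :: "bool list \<Rightarrow> 'a"
    assume "\<And>u. (u, w) \<in> measure weight \<Longrightarrow> P F u (F u)"
    then have IH: "F u \<in> A u" "compose (vertices (weight u)) F (lower u) \<in> C (weight u)"
      if "length u = n" "weight u < weight w" for u
      using that by (auto simp: P_def)
    show "\<exists>z. P F w z"
    proof (cases "length w = n")
      case True
      define m where "m = weight w"
      define f where "f = compose (punctured m) F (lower w)"
      have below: "length (lower w v) = n" "weight (lower w v) < weight w" if "v \<in> punctured m" for v
        using that True weight_lower[of v w] weight_less[of v m] by (auto simp: m_def)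
      have F_mem: "F u \<in> X" if "length u = n" "weight u < weight w" for u
        using cube_mem[OF IH(2)[OF that], of "ones (weight u)"] by (simp add: compose_def)
      have "corner X C m f"
        unfolding corner_def
      proof (intro conjI ballI)
        show "f \<in> punctured m \<rightarrow>\<^sub>E X"
          using below F_mem by (auto simp: f_def compose_def PiE_iff)
        fix i assume "i \<in> {1..m}"
        then have i: "1 \<le> i" "i \<le> m" by auto
        \<comment> \<open>The only zero of \<open>u\<close> is at \<open>i\<close>, so the
          \<open>i\<close>-th face of the corner is the subcube below \<open>lower w u\<close>, a
          cube by the induction hypothesis.\<close>
        define u where "u = face i False (ones (m - 1))"
        have u: "length u = m" "weight u = m - 1" "u \<in> punctured m"
          using i length_face weight_face_ones face_neq_ones by (auto simp: u_def)
        have *: "compose (vertices (m - 1)) F (lower (lower w u)) \<in> C (m - 1)"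
          using IH(2)[OF below[OF u(3)]] u weight_lower[of u w] by (simp add: m_def)
        show "compose (vertices (m - 1)) f (face i False) \<in> C (m - 1)"
        proof (rule cube_eqI[OF *])
          fix v :: "bool list" assume v: "length v = m - 1"
          have "face i False v = lower u v" "face i False v \<in> punctured m"
            using face_eq_lower[OF i v] length_face[OF i v] face_neq_ones[OF i v]
            unfolding u_def mem_punctured_iff by blast+
          then show "compose (vertices (m - 1)) F (lower (lower w u)) v =
              compose (vertices (m - 1)) f (face i False) v"
            using v u lower_lower[of u w v] by (simp add: compose_def f_def m_def)
        qed (simp add: compose_def)
      qed
      moreover have "\<forall>v\<in>punctured m. f v \<in> A (lower w v)"
        using below IH(1) by (auto simp: f_def compose_def)
      ultimately obtain c where c: "c \<in> C m" "restrict c (punctured m) = f" "c (ones m) \<in> A w"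
        using extend[of w f] True by (auto simp: m_def)
      have "compose (vertices m) (F(w := c (ones m))) (lower w) \<in> C m"
      proof (rule cube_eqI[OF c(1)])
        fix v :: "bool list" assume v: "length v = m"
        show "c v = compose (vertices m) (F(w := c (ones m))) (lower w) v"
        proof (cases "v = ones m")
          case True
          then show ?thesis by (simp add: compose_def m_def)
        next
          case False
          then have "c v = f v" using v c(2) by (metis mem_punctured_iff restrict_apply')
          then show ?thesis using v False lower_neq[of v w] by (simp add: compose_def f_def m_def)
        qed
      qed (simp add: compose_def)
      then show ?thesis using c(3) by (auto simp: P_def m_def)
    qed (auto simp: P_def)
  qed
  then obtain F where F: "F w \<in> A w" "compose (vertices (weight w)) F (lower w) \<in> C (weight w)"
    if "length w = n" for w
    by (auto simp: P_def)
  \<comment> \<open>The subcube below \<open>ones n\<close> is the whole cube, so admissibility of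
    the top value gives membership in \<open>C n\<close>.\<close>
  have "restrict F (vertices n) \<in> C n"
  proof (rule cube_eqI)
    show "compose (vertices n) F (lower (ones n)) \<in> C n" using F(2)[of "ones n"] by simp
  qed (simp_all add: compose_def lower_of_ones)
  then show ?thesis using F(1) by (intro bexI[of _ "restrict F (vertices n)"]) auto
qed

text \<open>
  Filling in a cube of dimension \<open>2 * n\<close> glues the \<open>2 ^ n\<close> small cubes of a subdivided cube.
  All of them come from \<open>c\<close> except the last one, where the value at the top vertex is changed.
\<close>

lemma tricube:
  assumes c: "c \<in> C n"
    and d: "(compose (vertices n) c (map (h False)))(ones n := y) \<in> C n"
  shows "(compose (vertices n) c (map (\<lambda>b. h (\<not> b) b)))(ones n := y) \<in> C n"
proof -
  define z where "z = antidiag (ones n)"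
  \<comment> \<open>Separated vertices are forced to the values to be glued: \<open>c\<close>
    through \<open>h\<close>, except \<open>y\<close> at \<open>z\<close>. Vertices with a pair
    (1,1) stay free, for completion to supply.\<close>
  define G where "G w = (if w = z then y else c (pairwise h w))" for w
  define A where "A w = (if separated w then {G w} else UNIV)" for w
  have "\<exists>F\<in>C (2 * n). \<forall>w\<in>vertices (2 * n). F w \<in> A w"
  proof (rule constrained_completion)
    fix w f
    assume w: "w \<in> vertices (2 * n)" and f: "corner X C (weight w) f"
      and fA: "\<forall>v\<in>punctured (weight w). f v \<in> A (lower w v)"
    show "\<exists>c\<in>C (weight w). restrict c (punctured (weight w)) = f \<and> c (ones (weight w)) \<in> A w"
    proof (cases "separated w")
      case False
      then show ?thesis using completion[OF f] by (auto simp: A_def)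
    next
      case True
      define g where "g = compose (vertices (weight w)) G (lower w)"
      have "g \<in> C (weight w)"
      \<comment> \<open>Below \<open>z\<close> the values are the small cube from hypothesis
        \<open>d\<close>. No other separated \<open>w\<close> has \<open>z\<close> below it, so
        there the values are a pullback of \<open>c\<close>.\<close>
      proof (cases "w = z")
        case True
        then have n: "weight w = n" by (simp add: z_def)
        show ?thesis
          unfolding n
        proof (rule cube_eqI[OF d])
          fix v :: "bool list" assume v: "length v = n"
          then have "lower z v = z \<longleftrightarrow> v = ones n"
            using lower_neq[of v z] lower_ones[of z] n True by metis
          then show "((compose (vertices n) c (map (h False)))(ones n := y)) v = g v"
            using v n True pairwise_lower_antidiag_ones[OF v, of h]
            by (simp add: g_def G_def compose_def z_def)
        qed (simp add: g_def n compose_def)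
      next
        case False
        then have "lower w v \<noteq> z" for v
          using antidiag_ones_maximal True w by (auto simp: z_def)
        then show ?thesis
          using presheaf[OF c morphism_pairwise_lower[OF True, of n h]] w
          by (auto elim!: cube_eqI simp: g_def G_def compose_def)
      qed
      moreover have "restrict g (punctured (weight w)) = f"
      proof (rule extensionalityI[of _ "punctured (weight w)"])
        show "f \<in> extensional (punctured (weight w))"
          using f by (auto simp: corner_def PiE_iff)
        show "restrict g (punctured (weight w)) v = f v" if "v \<in> punctured (weight w)" for v
          using fA that separated_lower[OF True] by (auto simp: g_def compose_def A_def)
      qed simp
      moreover have "g (ones (weight w)) \<in> A w"
        using True by (simp add: g_def A_def compose_def)
      ultimately show ?thesis by blast
    qed
  qed
  then obtain F where F: "F \<in> C (2 * n)" "\<And>w. length w = 2 * n \<Longrightarrow> F w \<in> A w" by auto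
  have F_antidiag: "F (antidiag v) = (if v = ones n then y else c (map (\<lambda>b. h (\<not> b) b) v))"
    if "length v = n" for v
    using F(2)[of "antidiag v"] that by (simp add: A_def G_def z_def)
  show ?thesis
    by (rule cube_eqI[OF presheaf[OF F(1) morphism_antidiag]])
      (auto simp: compose_def F_antidiag extensional_def)
qed

section \<open>The relations \<open>\<sim>\<^sub>k\<close>\<close>

lemma cube_undefined: "c \<in> C n \<Longrightarrow> length v \<noteq> n \<Longrightarrow> c v = undefined"
  using cubes[of n] by (auto simp: PiE_iff extensional_def)

text \<open>Two gluings transfer the change of top value: from the witnesses of \<open>sim\<close>
  to a constant cube, and from there to \<open>c\<close>.\<close>

lemma modify_top:
  assumes c: "c \<in> C (Suc k)" and sim: "(c (ones (Suc k)), y) \<in> sim X C k"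
  shows "c(ones (Suc k) := y) \<in> C (Suc k)"
proof -
  let ?n = "Suc k"
  obtain c\<^sub>1 c\<^sub>2 where c\<^sub>1: "c\<^sub>1 \<in> C ?n" "c\<^sub>1 (ones ?n) = c (ones ?n)"
    and c\<^sub>2: "c\<^sub>2 \<in> C ?n" "c\<^sub>2 (ones ?n) = y" "\<forall>v\<in>punctured ?n. c\<^sub>1 v = c\<^sub>2 v"
    using sim by (auto simp: sim_def simp del: ones_simps)
  have map_or: "map ((\<or>) False) v = v" for v
    by (induction v) auto
  \<comment> \<open>For \<open>h = (\<or>)\<close> the last small cube is \<open>c\<^sub>1\<close>
    with top changed to \<open>y\<close>, that is \<open>c\<^sub>2\<close>; the outer cube is
    constant apart from \<open>y\<close> at the top.\<close>
  have "(compose (vertices ?n) c\<^sub>1 (map ((\<or>) False)))(ones ?n := y) \<in> C ?n"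
    by (rule cube_eqI[OF c\<^sub>2(1)])
      (use c\<^sub>2 in \<open>auto simp: compose_def extensional_def map_or simp del: ones_simps\<close>)
  from tricube[OF c\<^sub>1(1), where h = "(\<or>)", OF this]
  have *: "(compose (vertices ?n) c\<^sub>1 (map (\<lambda>b. \<not> b \<or> b)))(ones ?n := y) \<in> C ?n" .
  have map_True: "map (\<lambda>_. True) v = ones ?n" if "length v = ?n" for v :: "bool list"
    using that by (simp add: map_replicate_const ones_def)
  \<comment> \<open>For \<open>h = (\<lambda>a _. \<not> a)\<close> the roles are reversed: the last
    small cube is constant apart from \<open>y\<close>, the outer cube is \<open>c\<close> with its
    top changed.\<close>
  have "(compose (vertices ?n) c (map ((\<lambda>a _. \<not> a) False)))(ones ?n := y) \<in> C ?n"
    by (rule cube_eqI[OF *])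
      (auto simp: compose_def extensional_def map_True c\<^sub>1(2) simp del: ones_simps)
  from tricube[OF c, where h = "\<lambda>a _. \<not> a", OF this] show ?thesis
    by (rule cube_eqI)
      (auto simp: compose_def extensional_def cube_undefined[OF c] simp del: ones_simps)
qed

lemma simI:
  assumes "c\<^sub>1 \<in> C (Suc k)" "c\<^sub>2 \<in> C (Suc k)" "\<And>v. v \<in> punctured (Suc k) \<Longrightarrow> c\<^sub>1 v = c\<^sub>2 v"
  shows "(c\<^sub>1 (ones (Suc k)), c\<^sub>2 (ones (Suc k))) \<in> sim X C k"
  using assms cube_mem unfolding sim_def
  by (auto simp del: ones_simps mem_punctured_iff)

lemma sim_refl: "x \<in> X \<Longrightarrow> (x, x) \<in> sim X C k"
  using simI[OF const_cube const_cube, of x x k] by simp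

lemma sim_sym: "(x, y) \<in> sim X C k \<Longrightarrow> (y, x) \<in> sim X C k"
  unfolding sim_def by (auto, metis)

lemma sim_mem: "(x, y) \<in> sim X C k \<Longrightarrow> x \<in> X \<and> y \<in> X"
  by (auto simp: sim_def)

lemma sim_trans:
  assumes "(x, y) \<in> sim X C k" "(y, z) \<in> sim X C k"
  shows "(x, z) \<in> sim X C k"
proof -
  \<comment> \<open>Changing the top of the constant cube at \<open>y\<close> to \<open>x\<close>
    and to \<open>z\<close> gives two cubes that agree elsewhere.\<close>
  let ?c = "\<lambda>v\<in>vertices (Suc k). y"
  have "?c \<in> C (Suc k)" using assms sim_mem const_cube by blast
  moreover have "?c (ones (Suc k)) = y" by (simp del: ones_simps)
  ultimately have "?c(ones (Suc k) := x) \<in> C (Suc k)" "?c(ones (Suc k) := z) \<in> C (Suc k)"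
    using modify_top assms sim_sym by metis+
  from simI[OF this] show ?thesis by (simp del: ones_simps)
qed

lemma equiv_sim: "equiv X (sim X C k)"
proof (intro equivI refl_onI symI transI)
  show "sim X C k \<subseteq> X \<times> X" using sim_mem by auto
qed (fact sim_refl sim_sym sim_trans)+

text \<open>A reflection moves \<open>w\<close> to the top, where \<open>modify_top\<close> applies;
  applied again, it moves \<open>w\<close> back.\<close>

lemma modify_vertex:
  assumes c: "c \<in> C (Suc k)" and w: "length w = Suc k" and sim: "(c w, y) \<in> sim X C k"
  shows "c(w := y) \<in> C (Suc k)"
proof -
  let ?n = "Suc k" and ?r = "map2 (=) w"
  have r: "morphism ?n ?n ?r" using morphism_reflection[of w] w by simp
  note r_simps = reflection_eq_ones_iff[OF w] reflection_involution[OF w]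
  have r_ones: "?r (ones ?n) = w" using r_simps(2)[of w] r_simps(1)[of w] w by simp
  have "(compose (vertices ?n) c ?r)(ones ?n := y) \<in> C ?n"
    using sim r_ones by (intro modify_top presheaf[OF c r]) (simp add: compose_def)
  from presheaf[OF this r] show ?thesis
    by (rule cube_eqI)
      (use w r_simps in \<open>auto simp: compose_def extensional_def cube_undefined[OF c] simp del: ones_simps\<close>)
qed

section \<open>Changing values within classes\<close>

lemma saturated_Suc:
  assumes c: "c \<in> C (Suc k)" and d: "d \<in> extensional (vertices (Suc k))"
    and sim: "\<And>v. length v = Suc k \<Longrightarrow> (c v, d v) \<in> sim X C k"
  shows "d \<in> C (Suc k)"
proof -
  \<comment> \<open>\<open>D\<close> collects the vertices already changed; outside \<open>D\<close>
    the value is still that of \<open>c\<close>, so \<open>modify_vertex\<close> applies.\<close>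
  have "D \<subseteq> vertices (Suc k) \<Longrightarrow> override_on c d D \<in> C (Suc k)" if "finite D" for D
    using that
  proof (induction D)
    case (insert w D)
    then have "(override_on c d D)(w := d w) \<in> C (Suc k)"
      using sim by (intro modify_vertex) (auto simp: override_on_def)
    moreover have "(override_on c d D)(w := d w) = override_on c d (insert w D)"
      by (auto simp: override_on_def)
    ultimately show ?case by simp
  qed (simp add: c)
  from this[OF finite_vertices order_refl] show ?thesis
    by (rule cube_eqI) (simp_all add: d)
qed

text \<open>The cube is pulled back along a projection from dimension \<open>Suc k\<close>, changed
  there, and restricted to the face with leading coordinates 1, on which the projection is a
  bijection.\<close>

lemma saturated:
  assumes c: "c \<in> C n" and n: "n \<le> Suc k" and d: "d \<in> extensional (vertices n)"
    and sim: "\<And>v. length v = n \<Longrightarrow> (c v, d v) \<in> sim X C k"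
  shows "d \<in> C n"
proof -
  define j where "j = Suc k - n"
  have j: "j + n = Suc k" using n by (simp add: j_def)
  have "compose (vertices (Suc k)) c (drop j) \<in> C (Suc k)"
    using presheaf[OF c morphism_drop[of j n]] by (simp add: j)
  then have "compose (vertices (Suc k)) d (drop j) \<in> C (Suc k)"
    by (rule saturated_Suc) (use sim in \<open>simp_all add: compose_def j_def n\<close>)
  moreover have "morphism n (Suc k) (append (replicate j True))"
    using morphism_append[of n "replicate j True"] by (simp add: j)
  ultimately have "compose (vertices n) (compose (vertices (Suc k)) d (drop j)) (append (replicate j True)) \<in> C n"
    by (rule presheaf)
  then show ?thesis
    by (rule cube_eqI) (use d in \<open>simp_all add: compose_def j\<close>)
qed

text \<open>The upper face of dimension \<open>Suc k\<close> through the top, embedded by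
  \<open>append u\<close>, suffices; there saturation turns relatedness off the top into equality
  off the top.\<close>

lemma unique_top:
  assumes c: "c \<in> C n" and d: "d \<in> C n" and n: "Suc k \<le> n"
    and sim: "\<And>v. v \<in> punctured n \<Longrightarrow> (c v, d v) \<in> sim X C k"
  shows "(c (ones n), d (ones n)) \<in> sim X C k"
proof -
  define u where "u = replicate (n - Suc k) True"
  have u: "length u + Suc k = n" "u @ v = ones n \<longleftrightarrow> v = ones (Suc k)" for v
    using n replicate_add[of "n - Suc k" "Suc k" True] by (simp_all add: u_def ones_def)
  have upper: "compose (vertices (Suc k)) e (append u) \<in> C (Suc k)" if "e \<in> C n" for e
    using presheaf[OF that] morphism_append[of "Suc k" u] u(1) by simp
  let ?c = "compose (vertices (Suc k)) c (append u)"
  let ?d = "compose (vertices (Suc k)) d (append u)"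
  \<comment> \<open>With the top value of \<open>?c\<close>, the modified \<open>?d\<close> is
    related to \<open>?c\<close> at every vertex, hence a cube; it agrees with \<open>?d\<close> off
    the top, as \<open>simI\<close> requires.\<close>
  let ?d' = "?d(ones (Suc k) := ?c (ones (Suc k)))"
  have "c (ones n) \<in> X" using cube_mem[OF c] by simp
  have "?d' \<in> C (Suc k)"
  proof (rule saturated_Suc[OF upper[OF c]])
    fix v :: "bool list" assume v: "length v = Suc k"
    show "(?c v, ?d' v) \<in> sim X C k"
    proof (cases "v = ones (Suc k)")
      case True
      then show ?thesis using sim_refl cube_mem[OF upper[OF c] v] by (simp del: ones_simps)
    next
      case False
      then have "u @ v \<in> punctured n" using u v by simp
      then show ?thesis using sim False v by (simp add: compose_def del: ones_simps)
    qed
  qed (auto simp: compose_def extensional_def simp del: ones_simps)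
  from simI[OF this upper[OF d]] have "(?c (ones (Suc k)), ?d (ones (Suc k))) \<in> sim X C k"
    by (simp del: ones_simps)
  then show ?thesis using u(2)[of "ones (Suc k)"] by (simp add: compose_def del: ones_simps)
qed

section \<open>The quotient by \<open>\<sim>\<^sub>k\<close>\<close>

lemma class_eq_iff:
  "x \<in> X \<Longrightarrow> y \<in> X \<Longrightarrow> sim X C k `` {x} = sim X C k `` {y} \<longleftrightarrow> (x, y) \<in> sim X C k"
  by (rule eq_equiv_class_iff[OF equiv_sim])

lemma quotient_class:
  assumes "a \<in> X // sim X C k" "x \<in> a"
  shows "x \<in> X" "sim X C k `` {x} = a"
  using assms equiv_class_eq[OF equiv_sim, of _ _ k] sim_mem by (auto elim!: quotientE)

lemma push_forwardI:
  "c \<in> C n \<Longrightarrow> compose (vertices n) (\<lambda>x. sim X C k `` {x}) c \<in> push_forward (sim X C k) C n"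
  by (auto simp: push_forward_def)

lemma push_forwardE:
  assumes "c' \<in> push_forward (sim X C k) C n"
  obtains c where "c \<in> C n" "c' = compose (vertices n) (\<lambda>x. sim X C k `` {x}) c"
  using assms by (auto simp: push_forward_def)

text \<open>\<open>c\<close> represents the prescribed classes, \<open>g\<close> the representatives
  already chosen. Up to dimension \<open>Suc k\<close> saturation lets the top value of
  \<open>c\<close> be kept; above it \<open>unique_top\<close> puts every completion of
  \<open>g\<close> into the right class.\<close>

lemma complete_near_cube:
  assumes c: "c \<in> C m" and g: "corner X C m g"
    and sim: "\<And>v. v \<in> punctured m \<Longrightarrow> (c v, g v) \<in> sim X C k"
  shows "\<exists>d\<in>C m. restrict d (punctured m) = g \<and> (c (ones m), d (ones m)) \<in> sim X C k"
proof (cases "m \<le> Suc k")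
  case True
  define d where "d = (\<lambda>v\<in>vertices m. if v = ones m then c v else g v)"
  have "d \<in> C m"
    by (rule saturated[OF c True])
      (use sim sim_refl cube_mem[OF c] in \<open>auto simp: d_def\<close>)
  moreover have "restrict d (punctured m) = g"
    using g by (auto simp: d_def corner_def PiE_iff extensional_def restrict_def fun_eq_iff)
  moreover have "(c (ones m), d (ones m)) \<in> sim X C k"
    using sim_refl cube_mem[OF c] by (simp add: d_def)
  ultimately show ?thesis by blast
next
  case False
  obtain d where d: "d \<in> C m" "restrict d (punctured m) = g"
    using completion[OF g] by blast
  then have "d v = g v" if "v \<in> punctured m" for v
    using that by (metis restrict_apply')
  then have "(c (ones m), d (ones m)) \<in> sim X C k"
    using False sim by (intro unique_top[OF c d(1)]) auto
  then show ?thesis using d by blast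
qed

text \<open>A vertex other than the top has a zero coordinate, so it lies in a face where
  \<open>f\<close> lifts to a cube; \<open>c\<close> is that lift below \<open>w\<close>. Lifts for
  different \<open>w\<close> match only up to \<open>sim\<close>.\<close>

lemma quotient_corner_lower:
  assumes f: "corner (X // sim X C k) (push_forward (sim X C k) C) n f" and w: "w \<in> punctured n"
  obtains c where "c \<in> C (weight w)"
    "\<And>v. length v = weight w \<Longrightarrow> lower w v \<noteq> ones n \<and> f (lower w v) = sim X C k `` {c v}"
proof -
  obtain i u where i: "1 \<le> i" "i \<le> n" and u: "length u = n - 1" and w_eq: "w = face i False u"
    using punctured_is_face[OF w] by blast
  define e where "e = face i False (ones (n - 1))"
  have w_lower: "w = lower e u" and weight_e: "weight e = n - 1"
    using face_eq_lower[OF i u] weight_face_ones[OF i] by (simp_all only: w_eq e_def)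
  have weight_w: "weight w = weight u"
    using weight_lower[of u e] w_lower weight_e u by simp
  have lower_w: "lower w v = face i False (lower u v)" if "length v = weight w" for v
    using that lower_lower[of u e v] face_eq_lower[OF i, of "lower u v"] u weight_e weight_w w_lower
    by (simp add: e_def)
  have "compose (vertices (n - 1)) f (face i False) \<in> push_forward (sim X C k) C (n - 1)"
    using f i by (simp add: corner_def)
  then obtain c where c: "c \<in> C (n - 1)" and
    fc: "compose (vertices (n - 1)) f (face i False) = compose (vertices (n - 1)) (\<lambda>x. sim X C k `` {x}) c"
    by (rule push_forwardE)
  have f_face: "f (face i False v) = sim X C k `` {c v}" if "length v = n - 1" for v
    using fun_cong[OF fc, of v] that by (simp add: compose_def)
  show thesis
  proof (rule that)
    show "compose (vertices (weight w)) c (lower u) \<in> C (weight w)"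
      using presheaf[OF c, of "weight w" "lower u"] morphism_lower[of u] u weight_w by simp
    show "lower w v \<noteq> ones n \<and>
        f (lower w v) = sim X C k `` {compose (vertices (weight w)) c (lower u) v}"
      if v: "length v = weight w" for v
      using face_neq_ones[OF i, of "lower u v"] f_face[of "lower u v"] u v lower_w[OF v]
      by (simp add: compose_def)
  qed
qed

lemma quotient_groupspace: "groupspace (X // sim X C k) (push_forward (sim X C k) C)"
proof
  show push: "push_forward (sim X C k) C n \<subseteq> vertices n \<rightarrow>\<^sub>E X // sim X C k" for n
    by (auto elim!: push_forwardE simp: compose_def intro!: quotientI cube_mem)
  show "compose (vertices n) \<psi> \<phi> \<in> push_forward (sim X C k) C n"
    if "\<psi> \<in> push_forward (sim X C k) C m" "morphism n m \<phi>" for \<psi> m n \<phi>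
    using that(1)
  proof (rule push_forwardE)
    fix c assume "c \<in> C m" "\<psi> = compose (vertices m) (\<lambda>x. sim X C k `` {x}) c"
    then show ?thesis
      using push_forwardI[OF presheaf[OF _ that(2)]] compose_compose_morphism[OF that(2)] by metis
  qed
  show "push_forward (sim X C k) C 1 = vertices 1 \<rightarrow>\<^sub>E X // sim X C k"
  proof (intro equalityI push subsetI)
    fix f assume f: "f \<in> vertices 1 \<rightarrow>\<^sub>E X // sim X C k"
    define g where "g = (\<lambda>v\<in>vertices 1. SOME x. x \<in> f v)"
    have g: "g v \<in> X" "sim X C k `` {g v} = f v" if v: "v \<in> vertices 1" for v
    proof -
      have fv: "f v \<in> X // sim X C k" using f v by blast
      then have "\<exists>x. x \<in> f v" using in_quotient_imp_non_empty[OF equiv_sim] by blast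
      then have "g v \<in> f v" using v unfolding g_def by (simp add: some_in_eq ex_in_conv)
      then show "g v \<in> X" "sim X C k `` {g v} = f v" using quotient_class[OF fv] by auto
    qed
    have "g \<in> C 1" unfolding ergodicity using g(1) by (auto simp: g_def)
    moreover have "compose (vertices 1) (\<lambda>x. sim X C k `` {x}) g = f"
      using f g(2) by (intro extensionalityI[of _ "vertices 1"]) (auto simp: compose_def PiE_iff)
    ultimately show "f \<in> push_forward (sim X C k) C 1" using push_forwardI by metis
  qed
  fix n f assume f: "corner (X // sim X C k) (push_forward (sim X C k) C) n f"
  \<comment> \<open>Elements of the quotient are subsets of \<open>X\<close>, so \<open>f w\<close>
    is itself the set of representatives allowed at \<open>w\<close>; at the top any element will
    do.\<close>
  define A where "A w = (if w = ones n then X else f w)" for w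
  have "\<exists>F\<in>C n. \<forall>w\<in>vertices n. F w \<in> A w"
  proof (rule constrained_completion)
    fix w g
    assume w: "w \<in> vertices n" and g: "corner X C (weight w) g"
      and gA: "\<forall>v\<in>punctured (weight w). g v \<in> A (lower w v)"
    show "\<exists>d\<in>C (weight w). restrict d (punctured (weight w)) = g \<and> d (ones (weight w)) \<in> A w"
    proof (cases "w = ones n")
      case True
      then show ?thesis using completion[OF g] cube_mem by (fastforce simp: A_def)
    next
      case False
      then obtain c where c: "c \<in> C (weight w)"
        "\<And>v. length v = weight w \<Longrightarrow> lower w v \<noteq> ones n \<and> f (lower w v) = sim X C k `` {c v}"
        using quotient_corner_lower[OF f] w by auto
      then have A: "A (lower w v) = sim X C k `` {c v}" if "length v = weight w" for v
        using that by (simp add: A_def)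
      have "(c v, g v) \<in> sim X C k" if "v \<in> punctured (weight w)" for v
        using gA A[of v] that by auto
      from complete_near_cube[OF c(1) g this] show ?thesis
        using A[of "ones (weight w)"] by auto
    qed
  qed
  then obtain F where F: "F \<in> C n" "\<And>w. length w = n \<Longrightarrow> F w \<in> A w" by auto
  have "restrict (compose (vertices n) (\<lambda>x. sim X C k `` {x}) F) (punctured n) = f"
  proof (rule extensionalityI[of _ "punctured n"])
    show "f \<in> extensional (punctured n)" using f by (auto simp: corner_def PiE_iff)
    fix w assume w: "w \<in> punctured n"
    then have "f w \<in> X // sim X C k" "F w \<in> f w"
      using f F(2)[of w] by (auto simp: corner_def A_def simp del: mem_punctured_iff) auto
    then show "restrict (compose (vertices n) (\<lambda>x. sim X C k `` {x}) F) (punctured n) w = f w"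
      using w quotient_class(2) by (simp add: compose_def)
  qed simp
  then show "\<exists>\<phi>\<in>push_forward (sim X C k) C n. restrict \<phi> (punctured n) = f"
    using push_forwardI[OF F(1)] by blast
qed

text \<open>Uniqueness remains: two completions have representatives related off the top, so
  \<open>unique_top\<close> in dimension \<open>k + 1\<close> relates them at the top too.\<close>

lemma quotient_step_groupspace: "step_groupspace k (X // sim X C k) (push_forward (sim X C k) C)"
proof -
  interpret Q: groupspace "X // sim X C k" "push_forward (sim X C k) C"
    by (rule quotient_groupspace)
  show ?thesis
  proof
    fix f assume f: "corner (X // sim X C k) (push_forward (sim X C k) C) (k + 1) f"
    have "\<phi> = \<psi>"
      if \<phi>: "\<phi> \<in> push_forward (sim X C k) C (k + 1)" "restrict \<phi> (punctured (k + 1)) = f"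
        and \<psi>: "\<psi> \<in> push_forward (sim X C k) C (k + 1)" "restrict \<psi> (punctured (k + 1)) = f"
      for \<phi> \<psi>
    proof -
      obtain c where c: "c \<in> C (k + 1)" "\<phi> = compose (vertices (k + 1)) (\<lambda>x. sim X C k `` {x}) c"
        using \<phi>(1) by (rule push_forwardE)
      obtain d where d: "d \<in> C (k + 1)" "\<psi> = compose (vertices (k + 1)) (\<lambda>x. sim X C k `` {x}) d"
        using \<psi>(1) by (rule push_forwardE)
      have iff: "\<phi> v = \<psi> v \<longleftrightarrow> (c v, d v) \<in> sim X C k" if "v \<in> vertices (k + 1)" for v
        using that cube_mem[OF c(1)] cube_mem[OF d(1)] class_eq_iff by (simp add: c d compose_def)
      have off: "\<phi> v = \<psi> v" if "v \<in> punctured (k + 1)" for v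
        using \<phi>(2) \<psi>(2) that by (metis restrict_apply')
      have "(c (ones (k + 1)), d (ones (k + 1))) \<in> sim X C k"
        using off iff by (intro unique_top[OF c(1) d(1)]) auto
      then have "\<phi> (ones (k + 1)) = \<psi> (ones (k + 1))" using iff by simp
      with off show "\<phi> = \<psi>"
        by (intro extensionalityI[of _ "vertices (k + 1)"])
          (auto simp: c d compose_def simp del: ones_simps)
    qed
    then show "\<exists>!\<phi>. \<phi> \<in> push_forward (sim X C k) C (k + 1) \<and> restrict \<phi> (punctured (k + 1)) = f"
      using Q.completion[OF f] by blast
  qed
qed

end

theorem theorem14p12:
  fixes X :: "'a set" and C :: "nat \<Rightarrow> (bool list \<Rightarrow> 'a) set" and i :: nat
  assumes "groupspace X C"
  shows "congruence X C (sim X C i) \<and>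
         step_groupspace i (X // sim X C i) (push_forward (sim X C i) C)"
  using groupspace.equiv_sim[OF assms] groupspace.quotient_groupspace[OF assms]
    groupspace.quotient_step_groupspace[OF assms]
  by (simp add: congruence_def)

end
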